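(* Let $r,\ell,k$ be integers with $r\ge 3$, $2\le \ell\le r$ and $k\ge 1+r-\ell$. Then $$\mathrm{cov}(r,\ell,k)\le 1+\Bigl\lfloor \frac{k-r+\ell-1}{\ell}\Bigr\rfloor .$$
   Context: For $1\le\ell\le r$, a hypergraph is complete $r$-uniform $(r,\ell)$-partite if its vertex set $V$ is partitioned into $r$ nonempty classes $V_1\cup\dots\cup V_r$ and its edge set consists of all $r$-element subsets of $V$ that intersect each class in at most $\ell$ vertices. A $k$-coloring of a hypergraph is an assignment of a color from $[k]=\{1,\dots,k\}$ to each edge (not all $k$ colors need be used). A coloring is spanning if every vertex is incident to edges of every color used in the coloring. For an edge-colored hypergraph $H$, let $H_i$ be the subhypergraph on vertex set $V(H)$ consisting of the edges of color $i$. A hypergraph is connected if it has only one vertex or any two distinct vertices can be connected by a sequence of edges each intersecting the next; every hypergraph is uniquely partitioned into connected components. A monochromatic component of $H$ is (the vertex set of) a connected component of $H_i$ for some color $i$. $\mathrm{cov}(r,\ell,k)$ is the minimum integer $m$ such that for every complete $r$-uniform $(r,\ell)$-partite hypergraph and every spanning $k$-coloring of its edges, the vertex set can be covered by at most $m$ monochromatic components. *)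

theory Defs
  imports Complex_Main "HOL-Library.Disjoint_Sets" "HOL-Library.Extended_Nat"
begin

text \<open>A hypergraph is given by its vertex set \<open>V :: 'a set\<close> and its edge set
  \<open>E :: 'a set set\<close>.\<close>

definition rl_partite_edges :: "nat \<Rightarrow> nat \<Rightarrow> 'a set \<Rightarrow> 'a set set \<Rightarrow> 'a set set" where
  "rl_partite_edges r l V P =
     {e. e \<subseteq> V \<and> finite e \<and> card e = r \<and> (\<forall>A\<in>P. card (e \<inter> A) \<le> l)}"

text \<open>\<open>partition_on\<close> requires the classes to be nonempty, pairwise disjoint and to cover \<open>V\<close>.\<close>

definition complete_rl_partite :: "nat \<Rightarrow> nat \<Rightarrow> 'a set \<Rightarrow> 'a set set \<Rightarrow> bool" where
  "complete_rl_partite r l V E \<longleftrightarrow>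
     (\<exists>P. partition_on V P \<and> finite P \<and> card P = r \<and> E = rl_partite_edges r l V P)"

definition edge_coloring :: "nat \<Rightarrow> 'a set set \<Rightarrow> ('a set \<Rightarrow> nat) \<Rightarrow> bool" where
  "edge_coloring k E c \<longleftrightarrow> (\<forall>e\<in>E. c e \<in> {1..k})"

text \<open>The set of colors that are actually used is \<open>c ` E\<close>.\<close>

definition spanning_coloring :: "'a set \<Rightarrow> 'a set set \<Rightarrow> ('a set \<Rightarrow> nat) \<Rightarrow> bool" where
  "spanning_coloring V E c \<longleftrightarrow> (\<forall>v\<in>V. \<forall>i\<in>c ` E. \<exists>e\<in>E. v \<in> e \<and> c e = i)"

definition joined_by_edges :: "'a set set \<Rightarrow> 'a \<Rightarrow> 'a \<Rightarrow> bool" where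
  "joined_by_edges E x y \<longleftrightarrow>
     (\<exists>es. es \<noteq> [] \<and> set es \<subseteq> E \<and> x \<in> hd es \<and> y \<in> last es \<and>
           successively (\<lambda>e f. e \<inter> f \<noteq> {}) es)"

text \<open>Vertex sets of the connected components, as equivalence classes; a vertex lying in no
  edge forms a component of its own.\<close>

definition hypergraph_components :: "'a set \<Rightarrow> 'a set set \<Rightarrow> 'a set set" where
  "hypergraph_components V E =
     V // {(x, y). x \<in> V \<and> y \<in> V \<and> (x = y \<or> joined_by_edges E x y)}"

definition monochromatic_components ::
    "nat \<Rightarrow> 'a set \<Rightarrow> 'a set set \<Rightarrow> ('a set \<Rightarrow> nat) \<Rightarrow> 'a set set" where
  "monochromatic_components k V E c =
     (\<Union>i\<in>{1..k}. hypergraph_components V {e \<in> E. c e = i})"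

definition covered_by_at_most :: "nat \<Rightarrow> 'a set \<Rightarrow> 'a set set \<Rightarrow> bool" where
  "covered_by_at_most m V M \<longleftrightarrow> (\<exists>C. C \<subseteq> M \<and> finite C \<and> card C \<le> m \<and> V \<subseteq> \<Union>C)"

text \<open>The type argument is the type from which vertices are drawn; vertex sets may be finite
  or infinite. The minimum is taken in \<open>enat\<close>, so that it would be \<open>\<infinity>\<close>, rather than an
  unspecified number, if no \<open>m\<close> were large enough.\<close>

definition cov :: "'a itself \<Rightarrow> nat \<Rightarrow> nat \<Rightarrow> nat \<Rightarrow> enat" where
  "cov T r l k = Inf (enat ` {m. \<forall>(V :: 'a set) E c.
     complete_rl_partite r l V E \<and> edge_coloring k E c \<and> spanning_coloring V E c \<longrightarrow>
       covered_by_at_most m V (monochromatic_components k V E c)})"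

end

theory Submission imports Defs begin

text \<open>Suppose that no \<open>m\<close> monochromatic components cover \<open>V\<close>, where \<open>k \<le> l m + (r - l)\<close>. Say that a
  color separates a set of vertices if no component of that color contains the set. An edge is not
  separated by its own color, so it suffices to find an \<open>r\<close>-set with at most \<open>l\<close> vertices in each
  class which is separated by all used colors. Vertices are added one at a time.

  Up to size \<open>l\<close>, where the class condition is void, a vertex outside \<open>m\<close> components containing the
  current set separates \<open>m\<close> more colors. Beyond size \<open>l\<close> each new vertex still separates one
  more color: as the coloring is spanning, every component contains an edge, and some vertex of that
  edge lies in a class that is not yet full. The first vertex separates nothing, so
  the count comes out only if the first two vertices together separate \<open>2 m\<close> colors. To find such
  a pair, take \<open>x, y\<close> joined by as few colors as possible and a third vertex \<open>z\<close> outside \<open>m\<close> of the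
  components joining them: by minimality at least \<open>m\<close> colors join \<open>x, z\<close> but not \<open>x, y\<close>, at least
  \<open>m\<close> colors join \<open>y, z\<close> but not \<open>x, y\<close>, and no color does both. For \<open>l = 2\<close> the triple \<open>x, y, z\<close>
  must not lie in one class, so the minimum is taken over pairs from different classes.\<close>

section \<open>Components\<close>

lemma joined_by_edges_sym:
  assumes "joined_by_edges E x y"
  shows "joined_by_edges E y x"
proof -
  obtain es where es: "es \<noteq> []" "set es \<subseteq> E" "x \<in> hd es" "y \<in> last es"
    "successively (\<lambda>e f. e \<inter> f \<noteq> {}) es"
    using assms by (auto simp: joined_by_edges_def)
  have "successively (\<lambda>e f. e \<inter> f \<noteq> {}) (rev es)"
    using es(5) by (simp add: Int_commute)
  with es show ?thesis
    unfolding joined_by_edges_def by (intro exI[of _ "rev es"]) (auto simp: hd_rev last_rev)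
qed

lemma joined_by_edges_trans:
  assumes "joined_by_edges E x y" "joined_by_edges E y z"
  shows "joined_by_edges E x z"
proof -
  obtain es where es: "es \<noteq> []" "set es \<subseteq> E" "x \<in> hd es" "y \<in> last es"
    "successively (\<lambda>e f. e \<inter> f \<noteq> {}) es"
    using assms(1) by (auto simp: joined_by_edges_def)
  obtain fs where fs: "fs \<noteq> []" "set fs \<subseteq> E" "y \<in> hd fs" "z \<in> last fs"
    "successively (\<lambda>e f. e \<inter> f \<noteq> {}) fs"
    using assms(2) by (auto simp: joined_by_edges_def)
  show ?thesis
    unfolding joined_by_edges_def
    by (intro exI[of _ "es @ fs"]) (use es fs in \<open>auto simp: successively_append_iff\<close>)
qed

lemma joined_by_edges_edge: "e \<in> E \<Longrightarrow> x \<in> e \<Longrightarrow> y \<in> e \<Longrightarrow> joined_by_edges E x y"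
  unfolding joined_by_edges_def by (intro exI[of _ "[e]"]) auto

text \<open>The relation whose quotient is \<open>hypergraph_components V E\<close>.\<close>

definition same_component :: "'a set \<Rightarrow> 'a set set \<Rightarrow> 'a rel" where
  "same_component V E = {(x, y). x \<in> V \<and> y \<in> V \<and> (x = y \<or> joined_by_edges E x y)}"

lemma equiv_same_component: "equiv V (same_component V E)"
  unfolding same_component_def
  by (intro equivI refl_onI symI transI)
    (auto intro: joined_by_edges_sym joined_by_edges_trans)

lemma same_component_edge: "e \<in> E \<Longrightarrow> e \<subseteq> V \<Longrightarrow> e \<times> e \<subseteq> same_component V E"
  by (auto simp: same_component_def intro: joined_by_edges_edge)

lemma card_triple_le: "card {x, y, z} \<le> 3"
  by (auto simp: card_insert_if)

section \<open>Colorings with no small cover\<close>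

text \<open>\<open>R i\<close> is the relation of lying in the same component of color \<open>i\<close>, and \<open>U\<close> is the set of used
  colors.\<close>

locale uncovered_coloring =
  fixes V :: "'a set" and P :: "'a set set" and U :: "nat set" and R :: "nat \<Rightarrow> 'a rel"
    and r l m :: nat
  assumes partition: "partition_on V P" and finite_P: "finite P" and card_P: "card P = r"
    and finite_U: "finite U"
    and r_ge: "3 \<le> r" and l_ge: "2 \<le> l" and l_le: "l \<le> r" and m_pos: "1 \<le> m"
    and equiv_R: "i \<in> U \<Longrightarrow> equiv V (R i)"
    and edge_joined: "e \<in> rl_partite_edges r l V P \<Longrightarrow> \<exists>i\<in>U. e \<times> e \<subseteq> R i"
    and spanning: "v \<in> V \<Longrightarrow> i \<in> U \<Longrightarrow> \<exists>e\<in>rl_partite_edges r l V P. v \<in> e \<and> e \<times> e \<subseteq> R i"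
    and uncovered: "x \<in> V \<Longrightarrow> T \<subseteq> U \<Longrightarrow> card T \<le> m \<Longrightarrow> \<exists>v\<in>V. \<forall>i\<in>T. (x, v) \<notin> R i"
    and card_U: "card U \<le> l * m + (r - l)"
begin

section \<open>Partial edges and the colors joining them\<close>

definition valid :: "'a set \<Rightarrow> bool" where
  "valid A \<longleftrightarrow> A \<subseteq> V \<and> finite A \<and> (\<forall>B\<in>P. card (A \<inter> B) \<le> l)"

text \<open>The complement in \<open>U\<close> of the colors separating \<open>A\<close>; progress
  is measured by how far this set shrinks.\<close>

definition J :: "'a set \<Rightarrow> nat set" where
  "J A = {i \<in> U. A \<times> A \<subseteq> R i}"

lemma J_subset: "J A \<subseteq> U"
  by (auto simp: J_def)

lemma finite_J [simp]: "finite (J A)"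
  using finite_U J_subset finite_subset by blast

lemma edge_iff_valid: "e \<in> rl_partite_edges r l V P \<longleftrightarrow> valid e \<and> card e = r"
  by (auto simp: rl_partite_edges_def valid_def)

lemma valid_if_small: "A \<subseteq> V \<Longrightarrow> finite A \<Longrightarrow> card A \<le> l \<Longrightarrow> valid A"
  unfolding valid_def by (meson card_mono Int_lower1 order_trans)

text \<open>By transitivity, \<open>v\<close> has to be compared with only one vertex of
  \<open>A\<close>.\<close>

lemma J_insert:
  assumes "x \<in> A" "A \<subseteq> V" "v \<in> V"
  shows "J (insert v A) = {i \<in> J A. (x, v) \<in> R i}"
proof -
  have "insert v A \<times> insert v A \<subseteq> R i \<longleftrightarrow> A \<times> A \<subseteq> R i \<and> (x, v) \<in> R i" if "i \<in> U" for i
  proof -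
    have R: "(v, v) \<in> R i" "sym (R i)" "trans (R i)"
      using equiv_R[OF that] assms(3) by (auto simp: equiv_def refl_on_def)
    have "(a, v) \<in> R i" "(v, a) \<in> R i" if "A \<times> A \<subseteq> R i" "(x, v) \<in> R i" "a \<in> A" for a
    proof -
      have "(a, x) \<in> R i"
        using that assms(1) by auto
      then show "(a, v) \<in> R i"
        using that(2) R(3) by (blast dest: transD)
      then show "(v, a) \<in> R i"
        using R(2) by (blast dest: symD)
    qed
    note this R(1)
    then show ?thesis
      using assms(1) by auto
  qed
  then show ?thesis
    unfolding J_def by blast
qed

lemma class_unique: "B \<in> P \<Longrightarrow> C \<in> P \<Longrightarrow> x \<in> B \<Longrightarrow> x \<in> C \<Longrightarrow> B = C"
  using partition unfolding partition_on_def disjoint_def by (metis IntI empty_iff)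

lemma card_eq_sum_classes:
  assumes "A \<subseteq> V" "finite A"
  shows "card A = (\<Sum>B\<in>P. card (A \<inter> B))"
proof -
  have "A = (\<Union>B\<in>P. A \<inter> B)"
    using assms(1) partition by (auto simp: partition_on_def)
  also have "card \<dots> = (\<Sum>B\<in>P. card (A \<inter> B))"
    using assms finite_P partition
    by (intro card_UN_disjoint) (auto simp: partition_on_def disjoint_def)
  finally show ?thesis .
qed

text \<open>Exchange property of a partition matroid: some class contains more vertices of
  \<open>e\<close> than of \<open>A\<close>, so it is not yet full.\<close>

lemma augment:
  assumes "valid A" "valid e" "card A < card e"
  shows "\<exists>w\<in>e - A. valid (insert w A)"
proof -
  have *: "A \<subseteq> V" "finite A" "e \<subseteq> V" "finite e"
    using assms by (auto simp: valid_def)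
  obtain B where B: "B \<in> P" "card (A \<inter> B) < card (e \<inter> B)"
    using assms(3) sum_mono[of P "\<lambda>B. card (e \<inter> B)" "\<lambda>B. card (A \<inter> B)"]
    unfolding card_eq_sum_classes[OF *(1,2)] card_eq_sum_classes[OF *(3,4)]
    by (meson not_le)
  have "\<not> e \<inter> B \<subseteq> A \<inter> B"
    using B(2) *(2) card_mono[of "A \<inter> B" "e \<inter> B"] by auto
  then obtain w where w: "w \<in> e" "w \<in> B" "w \<notin> A"
    by auto
  have "card (insert w A \<inter> C) \<le> l" if "C \<in> P" for C
  proof (cases "C = B")
    case True
    then show ?thesis
      using w B assms *(2) by (auto simp: valid_def Int_insert_left dest!: bspec[of P _ B])
  next
    case False
    then have "w \<notin> C"
      using w(2) B(1) that class_unique by auto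
    then show ?thesis
      using assms(1) that by (auto simp: valid_def)
  qed
  then have "valid (insert w A)"
    using assms(1) * w by (auto simp: valid_def)
  with w show ?thesis
    by auto
qed

text \<open>A transversal of the \<open>r\<close> classes is an edge.\<close>

lemma edges_nonempty: "\<exists>e. valid e \<and> card e = r"
proof -
  define f where "f B = (SOME x. x \<in> B)" for B :: "'a set"
  have f: "f B \<in> B" if "B \<in> P" for B
    using that partition unfolding f_def partition_on_def by (metis ex_in_conv someI)
  have disj: "B = C" if "B \<in> P" "C \<in> P" "f B \<in> C" for B C
    using that f[of B] class_unique by auto
  have "inj_on f P"
    using disj f by (metis inj_onI)
  then have "card (f ` P) = r"
    using card_P by (simp add: card_image)
  moreover have "f ` P \<subseteq> V"
    using f partition by (auto simp: partition_on_def)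
  moreover have "card (f ` P \<inter> C) \<le> l" if "C \<in> P" for C
  proof -
    have "f ` P \<inter> C \<subseteq> {f C}"
      using disj that by auto
    then have "card (f ` P \<inter> C) \<le> 1"
      using card_mono[of "{f C}" "f ` P \<inter> C"] by auto
    then show ?thesis
      using l_ge by simp
  qed
  ultimately show ?thesis
    using finite_P by (auto simp: valid_def)
qed

section \<open>Separating colors vertex by vertex\<close>

lemma separate_one:
  assumes "valid A" "A \<noteq> {}" "card A < r" "J A \<noteq> {}"
  shows "\<exists>w. w \<notin> A \<and> valid (insert w A) \<and> card (J (insert w A)) < card (J A)"
proof -
  obtain i x where i: "i \<in> J A" "i \<in> U" and x: "x \<in> A"
    using assms J_subset by blast
  have "A \<subseteq> V"
    using assms(1) by (auto simp: valid_def)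
  then obtain v where v: "v \<in> V" "(x, v) \<notin> R i"
    using uncovered[of x "{i}"] x i m_pos by auto
  \<comment> \<open>The class of \<open>v\<close> may be full, but all vertices of this edge lie in
    the component of \<open>v\<close>, so any of them that fits can replace it.\<close>
  obtain e where e: "valid e" "card e = r" "v \<in> e" "e \<times> e \<subseteq> R i"
    using spanning[OF v(1) i(2)] edge_iff_valid by blast
  obtain w where w: "w \<in> e" "w \<notin> A" "valid (insert w A)"
    using augment[OF assms(1) e(1)] assms(3) e(2) by auto
  have "(x, w) \<notin> R i"
    using v(2) e(3,4) w(1) equiv_R[OF i(2)] by (meson SigmaI equivE subsetD transD)
  then have "J (insert w A) \<subset> J A"
    using J_insert[OF x \<open>A \<subseteq> V\<close>, of w] w(3) i(1) by (auto simp: valid_def)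
  then show ?thesis
    using w by (meson finite_J psubset_card_mono)
qed

text \<open>Each new vertex removes a color from \<open>J A\<close> while one is left, so none is
  left when \<open>A\<close> has become an edge; but an edge is joined by its own color.\<close>

lemma not_separable:
  assumes "valid A" "A \<noteq> {}" "card (J A) + card A \<le> r"
  shows False
  using assms
proof (induction "r - card A" arbitrary: A)
  case 0
  then have "r \<le> card A"
    by simp
  then have "card (J A) = 0" "card A = r"
    using 0 by linarith+
  then have "J A = {}"
    by simp
  then show False
    using edge_joined[of A] 0 \<open>card A = r\<close> by (auto simp: edge_iff_valid J_def)
next
  case (Suc n)
  then have lt: "card A < r"
    by simp
  have fin: "finite A"
    using Suc.prems by (auto simp: valid_def)
  obtain w where w: "w \<notin> A" "valid (insert w A)" "card (J (insert w A)) \<le> card (J A) - 1"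
  proof (cases "J A = {}")
    \<comment> \<open>No color is left to separate, but \<open>A\<close> must still grow to an
      edge.\<close>
    case True
    obtain e w where "w \<in> e - A" "valid (insert w A)"
      using edges_nonempty augment Suc.prems(1) lt by metis
    moreover have "J (insert w A) \<subseteq> J A"
      by (auto simp: J_def)
    ultimately show ?thesis
      using True that by auto
  next
    case False
    then obtain w where "w \<notin> A" "valid (insert w A)" "card (J (insert w A)) < card (J A)"
      using separate_one[of A] Suc.prems lt by blast
    then show ?thesis
      using that by simp
  qed
  have "card (insert w A) = Suc (card A)"
    using w(1) fin by simp
  then have "n = r - card (insert w A)" "card (J (insert w A)) + card (insert w A) \<le> r"
    using Suc.hyps(2) Suc.prems(3) w(3) lt by linarith+
  then show False
    using Suc.hyps(1) w(2) by blast
qed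

lemma separate_many:
  assumes "A \<subseteq> V" "A \<noteq> {}"
  shows "\<exists>v\<in>V. card (J (insert v A)) \<le> card (J A) - m"
proof -
  obtain x where x: "x \<in> A"
    using assms(2) by auto
  \<comment> \<open>If fewer than \<open>m\<close> colors join \<open>A\<close>, all of them are
    taken, and the truncated subtraction gives 0.\<close>
  obtain T where T: "T \<subseteq> J A" "card T = min m (card (J A))"
    by (meson obtain_subset_with_card_n min.cobounded2)
  obtain v where v: "v \<in> V" "\<forall>i\<in>T. (x, v) \<notin> R i"
    using uncovered[of x T] T J_subset[of A] x assms(1) by auto
  have "J (insert v A) \<subseteq> J A - T"
    using J_insert[OF x assms(1) v(1)] v(2) by auto
  then have "card (J (insert v A)) \<le> card (J A - T)"
    by (intro card_mono) auto
  also have "\<dots> = card (J A) - card T"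
    using T(1) by (intro card_Diff_subset) (auto intro: finite_subset[OF _ finite_J])
  finally show ?thesis
    using v(1) T(2) by (auto simp: min_def split: if_splits)
qed

text \<open>Up to size \<open>l\<close> each vertex separates \<open>m\<close> colors;
  \<open>not_separable\<close> deals with the last \<open>r - l\<close>. The added vertex may
  already be in \<open>A\<close> if no color is left, hence only
  \<open>card A \<le> a\<close>.\<close>

lemma not_separable_small:
  assumes "A \<subseteq> V" "finite A" "A \<noteq> {}" "card A \<le> a" "a \<le> l"
    and "card (J A) \<le> m * (l - a) + (r - l)"
  shows False
  using assms
proof (induction "l - a" arbitrary: A a)
  case 0
  then have "l = a" "card (J A) + card A \<le> r"
    using l_le by auto
  then show False
    using not_separable valid_if_small 0 by blast
next
  case (Suc n)
  obtain v where v: "v \<in> V" "card (J (insert v A)) \<le> card (J A) - m"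
    using separate_many Suc.prems by blast
  have "l - a = Suc (l - Suc a)"
    using Suc.hyps(2) by simp
  then have "card (J (insert v A)) \<le> m * (l - Suc a) + (r - l)"
    using v(2) Suc.prems(6) by (simp add: algebra_simps)
  moreover have "card (insert v A) \<le> Suc a"
    using Suc.prems by (simp add: card_insert_if)
  moreover have "n = l - Suc a" "Suc a \<le> l"
    using Suc.hyps(2) by linarith+
  ultimately show False
    using Suc.hyps(1)[of "Suc a" "insert v A"] Suc.prems(1,2) v(1) by simp
qed

section \<open>Pairs joined by few colors\<close>

lemma pair_separates_less:
  assumes "x \<in> V" "y \<in> V"
  shows "card U < card (J {x, y}) + 2 * m"
proof (rule ccontr)
  assume "\<not> ?thesis"
  then have "card (J {x, y}) + 2 * m \<le> l * m + (r - l)"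
    using card_U by simp
  then have "card (J {x, y}) \<le> m * (l - 2) + (r - l)"
    using l_ge by (auto simp: algebra_simps diff_mult_distrib2)
  moreover have "card {x, y} \<le> 2"
    by (simp add: card_insert_if)
  ultimately show False
    using not_separable_small[of "{x, y}" 2] assms l_ge by auto
qed

text \<open>The point of the extremal choice of \<open>x, y\<close>.\<close>

lemma card_J_Diff_ge:
  assumes "x \<in> V" "y \<in> V" "z \<in> V"
    and "card (J {x, y}) \<le> card (J {x, z})"
    and "m \<le> card (J {x, y})" "card (J {z, x, y}) \<le> card (J {x, y}) - m"
  shows "m \<le> card (J {x, z} - J {x, y})"
proof -
  have "J {z, x, y} = J {x, z} \<inter> J {x, y}"
    using assms J_insert[of x "{x, y}" z] J_insert[of x "{x}" z] J_insert[of x "{x}" y]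
    by (auto simp: insert_commute)
  then have "card (J {x, z}) = card (J {x, z} - J {x, y}) + card (J {z, x, y})"
    using card_Int_Diff[of "J {x, z}" "J {x, y}"] by simp
  with assms(4-6) show ?thesis
    by linarith
qed

text \<open>Transitivity through \<open>z\<close>. It makes the two differences in
  \<open>card_U_ge\<close> disjoint.\<close>

lemma J_pairs_disjoint:
  assumes "x \<in> V" "y \<in> V" "z \<in> V"
  shows "J {x, z} \<inter> J {y, z} \<subseteq> J {x, y}"
proof
  fix i
  assume i: "i \<in> J {x, z} \<inter> J {y, z}"
  then have "i \<in> J (insert y {x, z})"
    using J_insert[of z "{x, z}" y] assms by (auto simp: J_def)
  then show "i \<in> J {x, y}"
    by (auto simp: J_def)
qed

text \<open>If both differences have at least \<open>m\<close> elements, this contradicts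
  \<open>pair_separates_less\<close>.\<close>

lemma card_U_ge:
  assumes "x \<in> V" "y \<in> V" "z \<in> V"
  shows "card (J {x, y}) + card (J {x, z} - J {x, y}) + card (J {y, z} - J {x, y}) \<le> card U"
proof -
  have "card (J {x, y}) + card (J {x, z} - J {x, y}) + card (J {y, z} - J {x, y}) =
    card (J {x, y} \<union> (J {x, z} - J {x, y}) \<union> (J {y, z} - J {x, y}))"
    using J_pairs_disjoint[OF assms] by (subst card_Un_disjoint; (subst card_Un_disjoint)?) auto
  also have "\<dots> \<le> card U"
    using J_subset finite_U by (intro card_mono) auto
  finally show ?thesis .
qed

lemma minimal_pair:
  assumes "D \<noteq> {}"
  obtains x y where "(x, y) \<in> D"
    "\<And>u v. (u, v) \<in> D \<Longrightarrow> card (J {x, y}) \<le> card (J {u, v})"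
proof -
  obtain p where p: "p \<in> D" "\<And>q. q \<in> D \<Longrightarrow> card (J {fst p, snd p}) \<le> card (J {fst q, snd q})"
    using assms ex_has_least_nat[of "\<lambda>p. p \<in> D" _ "\<lambda>p. card (J {fst p, snd p})"]
    by (metis ex_in_conv)
  show ?thesis
  proof
    show "(fst p, snd p) \<in> D"
      using p by simp
    show "card (J {fst p, snd p}) \<le> card (J {u, v})" if "(u, v) \<in> D" for u v
      using p(2)[OF that] by simp
  qed
qed

section \<open>The case of \<open>l\<close> at least 3\<close>

lemma l_less_3: "l < 3"
proof (rule ccontr)
  assume l3: "\<not> l < 3"
  have "V \<noteq> {}"
    using card_P partition r_ge by (auto simp: partition_on_empty)
  then have "V \<times> V \<noteq> {}"
    by auto
  then obtain x y where "(x, y) \<in> V \<times> V"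
    and min: "\<And>u v. (u, v) \<in> V \<times> V \<Longrightarrow> card (J {x, y}) \<le> card (J {u, v})"
    by (rule minimal_pair) blast
  then have xy: "x \<in> V" "y \<in> V"
    by auto
  obtain z where z: "z \<in> V" "card (J {z, x, y}) \<le> card (J {x, y}) - m"
    using separate_many[of "{x, y}"] xy by auto
  \<comment> \<open>This shows that the subtraction in the choice of \<open>z\<close> was not
    truncated.\<close>
  have "card (J {z, x, y}) \<noteq> 0"
    using not_separable_small[of "{z, x, y}" 3] l3 xy z(1) card_triple_le[of z x y] by auto
  then have ge: "m \<le> card (J {x, y})"
    using z(2) by linarith
  have "m \<le> card (J {x, z} - J {x, y})" "m \<le> card (J {y, z} - J {x, y})"
    using card_J_Diff_ge[of x y z] card_J_Diff_ge[of y x z] xy z ge min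
    by (auto simp: insert_commute)
  then show False
    using card_U_ge[OF xy z(1)] pair_separates_less[OF xy] by linarith
qed

section \<open>The case \<open>l = 2\<close>\<close>

definition in_same_class :: "'a \<Rightarrow> 'a \<Rightarrow> bool" where
  "in_same_class x y \<longleftrightarrow> (\<exists>B\<in>P. x \<in> B \<and> y \<in> B)"

lemma in_same_class_trans: "in_same_class x y \<Longrightarrow> in_same_class y z \<Longrightarrow> in_same_class x z"
  unfolding in_same_class_def using class_unique by metis

lemma in_same_class_sym: "in_same_class x y \<Longrightarrow> in_same_class y x"
  by (auto simp: in_same_class_def)

lemma ex_distinct_classes: "\<exists>x\<in>V. \<exists>y\<in>V. \<not> in_same_class x y"
proof -
  obtain B C where BC: "B \<in> P" "C \<in> P" "B \<noteq> C"
    using card_P r_ge finite_P card_le_Suc0_iff_eq[of P] by auto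
  have "B \<noteq> {}" "C \<noteq> {}"
    using BC partition by (auto simp: partition_on_def)
  then obtain x y where "x \<in> B" "y \<in> C"
    by blast
  moreover from this have "x \<in> V" "y \<in> V"
    using BC partition by (auto simp: partition_on_def)
  ultimately show ?thesis
    using BC class_unique unfolding in_same_class_def by metis
qed

text \<open>No class contains both \<open>x\<close> and \<open>y\<close>, so each has at most two of
  the three vertices.\<close>

lemma valid_triple:
  assumes "x \<in> V" "y \<in> V" "z \<in> V" "\<not> in_same_class x y"
  shows "valid {z, x, y}"
proof -
  have "card ({z, x, y} \<inter> B) \<le> l" if "B \<in> P" for B
  proof -
    have "{z, x, y} \<inter> B \<subseteq> {z, x} \<or> {z, x, y} \<inter> B \<subseteq> {z, y}"
      using assms(4) that by (auto simp: in_same_class_def)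
    moreover have "card {z, x} \<le> 2" "card {z, y} \<le> 2"
      by (auto simp: card_insert_if)
    ultimately have "card ({z, x, y} \<inter> B) \<le> 2"
      by (meson card_mono finite.intros order_trans)
    then show ?thesis
      using l_ge by simp
  qed
  then show ?thesis
    using assms by (auto simp: valid_def)
qed

text \<open>If \<open>z\<close> is in the class of \<open>x\<close>, minimality says nothing about \<open>J {x, z}\<close>; but then either
  the triple separates \<open>2 m + 1\<close> colors or the pair \<open>x, z\<close> already separates \<open>2 m\<close>.\<close>

lemma third_vertex_not_in_class:
  assumes "l = 2" and xy: "x \<in> V" "y \<in> V" "\<not> in_same_class x y"
    and min: "\<And>u v. u \<in> V \<Longrightarrow> v \<in> V \<Longrightarrow> \<not> in_same_class u v \<Longrightarrow>
      card (J {x, y}) \<le> card (J {u, v})"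
    and z: "z \<in> V" "card (J {z, x, y}) \<le> card (J {x, y}) - m" and ge: "m \<le> card (J {x, y})"
  shows "\<not> in_same_class x z"
proof
  assume xz: "in_same_class x z"
  then have yz: "\<not> in_same_class y z"
    using xy(3) in_same_class_sym in_same_class_trans by blast
  have d: "m \<le> card (J {y, z} - J {x, y})"
    using card_J_Diff_ge[of y x z] xy z ge min[OF xy(2) z(1) yz] by (simp add: insert_commute)
  have "\<not> card (J {z, x, y}) + 3 \<le> r"
    using not_separable[OF valid_triple[OF xy(1,2) z(1) xy(3)]] card_triple_le[of z x y] by auto
  then have "card U \<le> card (J {z, x, y}) + 2 * m"
    using card_U \<open>l = 2\<close> r_ge by simp
  \<comment> \<open>The colors joining \<open>x, y\<close> and those joining only
    \<open>y, z\<close> already exhaust \<open>U\<close>.\<close>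
  then have "card (J {x, z} - J {x, y}) = 0"
    using z(2) ge d card_U_ge[OF xy(1,2) z(1)] by linarith
  then have "J {x, z} \<subseteq> J {x, y}"
    by simp
  then have "J {x, z} \<subseteq> J {z, x, y}"
    using J_insert[of x "{x, y}" z] xy z(1) by (auto simp: J_def)
  then have "card (J {x, z}) \<le> card (J {z, x, y})"
    by (intro card_mono) auto
  then show False
    using pair_separates_less[OF xy(1) z(1)] d z(2) ge card_U_ge[OF xy(1,2) z(1)] by linarith
qed

lemma contradiction: False
proof -
  have l2: "l = 2"
    using l_less_3 l_ge by simp
  let ?D = "{(x, y) \<in> V \<times> V. \<not> in_same_class x y}"
  have "?D \<noteq> {}"
    using ex_distinct_classes by auto
  then obtain x y where D: "(x, y) \<in> ?D"
    "\<And>u v. (u, v) \<in> ?D \<Longrightarrow> card (J {x, y}) \<le> card (J {u, v})"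
    by (rule minimal_pair) blast
  then have xy: "x \<in> V" "y \<in> V" "\<not> in_same_class x y"
    and min: "\<And>u v. u \<in> V \<Longrightarrow> v \<in> V \<Longrightarrow> \<not> in_same_class u v \<Longrightarrow>
      card (J {x, y}) \<le> card (J {u, v})"
    using D by auto
  obtain z where z: "z \<in> V" "card (J {z, x, y}) \<le> card (J {x, y}) - m"
    using separate_many[of "{x, y}"] xy by auto
  have "card (J {z, x, y}) \<noteq> 0"
    using not_separable[OF valid_triple[OF xy(1,2) z(1) xy(3)]] r_ge card_triple_le[of z x y] by auto
  then have ge: "m \<le> card (J {x, y})"
    using z(2) by linarith
  have "\<not> in_same_class x z"
    using third_vertex_not_in_class[OF l2 xy min z ge] .
  moreover have "\<not> in_same_class y z"
    using third_vertex_not_in_class[OF l2, of y x z] xy min z ge in_same_class_sym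
    by (auto simp: insert_commute)
  ultimately have "m \<le> card (J {x, z} - J {x, y})" "m \<le> card (J {y, z} - J {x, y})"
    using card_J_Diff_ge[of x y z] card_J_Diff_ge[of y x z] xy z ge min
    by (auto simp: insert_commute)
  then show False
    using card_U_ge[OF xy(1,2) z(1)] pair_separates_less[OF xy(1,2)] by linarith
qed

end

section \<open>The bound\<close>

lemma covered_by_components:
  assumes "3 \<le> r" "2 \<le> l" "l \<le> r" "1 \<le> m" "k \<le> l * m + (r - l)"
    and "complete_rl_partite r l V E" "edge_coloring k E c" "spanning_coloring V E c"
  shows "covered_by_at_most m V (monochromatic_components k V E c)"
proof (rule ccontr)
  assume nc: "\<not> ?thesis"
  obtain P where P: "partition_on V P" "finite P" "card P = r" "E = rl_partite_edges r l V P"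
    using assms(6) by (auto simp: complete_rl_partite_def)
  define R where "R i = same_component V {e \<in> E. c e = i}" for i
  have U: "c ` E \<subseteq> {1..k}"
    using assms(7) by (auto simp: edge_coloring_def)
  have edge: "e \<times> e \<subseteq> R (c e)" if "e \<in> E" for e
    unfolding R_def using that P(4)
    by (intro same_component_edge) (auto simp: rl_partite_edges_def)
  interpret uncovered_coloring V P "c ` E" R r l m
  proof
    show "equiv V (R i)" for i
      unfolding R_def by (rule equiv_same_component)
    show "\<exists>i\<in>c ` E. e \<times> e \<subseteq> R i" if "e \<in> rl_partite_edges r l V P" for e
      using that edge P(4) by auto
    show "\<exists>e\<in>rl_partite_edges r l V P. v \<in> e \<and> e \<times> e \<subseteq> R i" if "v \<in> V" "i \<in> c ` E" for v i
      using that edge P(4) assms(8) unfolding spanning_coloring_def by metis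
    \<comment> \<open>Otherwise the components through \<open>x\<close> of the colors in
      \<open>T\<close> would be a cover.\<close>
    show "\<exists>v\<in>V. \<forall>i\<in>T. (x, v) \<notin> R i" if "x \<in> V" "T \<subseteq> c ` E" "card T \<le> m" for x T
    proof (rule ccontr)
      assume "\<not> ?thesis"
      then have "V \<subseteq> \<Union> ((\<lambda>i. R i `` {x}) ` T)"
        by auto
      moreover have "finite T"
        using that(2) U by (meson finite_atLeastAtMost finite_subset)
      moreover have "(\<lambda>i. R i `` {x}) ` T \<subseteq> monochromatic_components k V E c"
        using that U
        unfolding monochromatic_components_def hypergraph_components_def R_def
          same_component_def[symmetric]
        by (blast intro: quotientI)
      ultimately have "covered_by_at_most m V (monochromatic_components k V E c)"
        unfolding covered_by_at_most_def using that(3)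
        by (intro exI[of _ "(\<lambda>i. R i `` {x}) ` T"]) (auto intro: card_image_le order_trans)
      with nc show False ..
    qed
    show "finite (c ` E)"
      using U finite_subset by blast
    show "card (c ` E) \<le> l * m + (r - l)"
      using card_mono[OF _ U] assms(5) by simp
  qed (use P assms in auto)
  show False
    by (rule contradiction)
qed

theorem theorem3p4:
  fixes r l k :: nat
  assumes "r \<ge> 3" and "2 \<le> l" and "l \<le> r" and "int k \<ge> 1 + int r - int l"
  shows "cov TYPE('a) r l k \<le> enat (1 + nat \<lfloor>(real k - real r + real l - 1) / real l\<rfloor>)"
proof -
  \<comment> \<open>The assumption on \<open>k\<close> ensures that this subtraction is
    exact.\<close>
  define n where "n = k + l - r - 1"
  have n: "k + l = n + r + 1"
    using assms unfolding n_def by linarith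
  have "real k - real r + real l - 1 = real n"
    using n by (simp flip: of_nat_add add: algebra_simps)
  then have m: "nat \<lfloor>(real k - real r + real l - 1) / real l\<rfloor> = n div l"
    by (simp add: floor_divide_of_nat_eq)
  \<comment> \<open>As \<open>k = n + 1 + (r - l)\<close>, the number \<open>1 + n div l\<close> is
    the least \<open>m\<close> with \<open>k \<le> l * m + (r - l)\<close>.\<close>
  have "n < l * (1 + n div l)"
    using dividend_less_times_div[of l n] assms(2) by simp
  then have "k \<le> l * (1 + n div l) + (r - l)"
    using n assms(3) by linarith
  then show ?thesis
    unfolding cov_def m
    using assms(1-3)
    by (intro Inf_lower imageI CollectI allI impI covered_by_components[of r l]) auto
qed

end
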